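(* Let $\mathcal M=(\{1,2\},S,A,P,R_2,\gamma,\sigma)$ be a finite two-agent MDP, $\pi_1^0\in\Pi^1$ a default policy, $\pi_2^\dagger\in\Pi^2_{\mathrm{det}}$ a target policy, $\epsilon\ge0$ and $p\ge1$. Any solution $\pi_1\in\Pi^1$ of the attack problem (P1), if it exists (i.e., any $\pi_1$ satisfying the constraints of (P1)), satisfies $$\mathrm{Cost}(\pi_1,\pi_1^0)\ \ge\ \frac{1-\gamma}{2}\cdot\frac{\|\overline\chi_0\|_\infty}{\|R_2\|_\infty+\gamma\,\|V^{\pi_1^0,\pi_2^\dagger}\|_\infty}.$$
   Context: A two-agent MDP $\mathcal M=(\{1,2\},S,A,P,R_2,\gamma,\sigma)$ has finite state space $S$, finite joint action space $A=A_1\times A_2$, transition model $P(s,a_1,a_2,s')$, reward function $R_2:S\times A_1\times A_2\to\mathbb R$ of agent 2, discount factor $\gamma$ ($0\le\gamma<1$), initial state distribution $\sigma$. The environment need not be ergodic. $\Pi^i$ is the set of stochastic stationary policies $\pi_i:S\to\mathcal P(A_i)$, with $\pi_i(s,a_i)$ the probability of $a_i$ in $s$; $\Pi^2_{\mathrm{det}}\subseteq\Pi^2$ is the set of deterministic policies. $\rho_2^{\pi_1,\pi_2}=(1-\gamma)\,\mathbb E[\sum_{t\ge1}\gamma^{t-1}R_2(s_t,a_{1,t},a_{2,t})\mid\sigma,\pi_1,\pi_2]$; $\mu^{\pi_1,\pi_2}(s)=(1-\gamma)\,\mathbb E[\sum_{t\ge1}\gamma^{t-1}\mathbf 1[s_t=s]\mid\sigma,\pi_1,\pi_2]$;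 $V^{\pi_1,\pi_2}(s)=\mathbb E[\sum_{t\ge1}\gamma^{t-1}R_2(s_t,a_{1,t},a_{2,t})\mid s_1=s,\pi_1,\pi_2]$. Neighbor policy: $\pi\{s,a\}$ equals $\pi$ in all states except $s$, where it takes $a$ with probability 1. $\Pi_2^\dagger(\pi_1)$ is the set of policies $\pi_2$ with $\pi_2(s,\cdot)=\pi_2^\dagger(s,\cdot)$ whenever $\mu^{\pi_1,\pi_2^\dagger}(s)>0$. The attack problem (P1): minimize $\mathrm{Cost}(\pi_1,\pi_1^0)$ over $\pi_1\in\Pi^1$ subject to $\rho_2^{\pi_1,\pi_2^\dagger}\ge\rho_2^{\pi_1,\pi_2}+\epsilon$ for all $\pi_2\in\Pi^2_{\mathrm{det}}\setminus\Pi_2^\dagger(\pi_1)$. Here $$\mathrm{Cost}(\pi_1,\pi_1^0)=\Big(\sum_{s}\Big(\sum_{a_1}|\pi_1(s,a_1)-\pi_1^0(s,a_1)|\Big)^{p}\Big)^{1/p}.$$ For $\epsilon'\ge0$, with $[x]^+=\max(0,x)$, $$\overline\chi_{\epsilon'}(s,a_2)=\left[\frac{\rho_2^{\pi_1^0,\pi_2^\dagger\{s,a_2\}}-\rho_2^{\pi_1^0,\pi_2^\dagger}+\epsilon'}{\mu^{\pi_1^0,\pi_2^\dagger\{s,a_2\}}(s)}\right]^+$$ if $\mu^{\pi_1,\pi_2^\dagger}(s)>0$ for all $\pi_1\in\Pi^1$ and $\pi_2^\dagger(s,a_2)=0$; otherwise $\overline\chi_{\epsilon'}(s,a_2)=0$.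 $\|\cdot\|_\infty$ is the maximum absolute value over entries; the ratio $0/0$ (which occurs when $R_2=0$) is read as $0$. *)

theory Defs
  imports "HOL-Probability.Probability"
begin

text \<open>
  The states and the actions of the two agents form (finite, nonempty) types. A stationary
  stochastic policy is a function from states to probability mass functions, so the policy
  classes of agents 1 and 2 are the full types \<open>'s \<Rightarrow> 'a1 pmf\<close> and \<open>'s \<Rightarrow> 'a2 pmf\<close>.
\<close>

record ('s, 'a1, 'a2) two_agent_mdp =
  trans :: "'s \<Rightarrow> 'a1 \<Rightarrow> 'a2 \<Rightarrow> 's pmf"
  reward2 :: "'s \<Rightarrow> 'a1 \<Rightarrow> 'a2 \<Rightarrow> real"
  discount :: real
  init_dist :: "'s pmf"

type_synonym ('s, 'a) policy = "'s \<Rightarrow> 'a pmf"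

definition deterministic :: "('s, 'a) policy \<Rightarrow> bool" where
  "deterministic \<pi> \<longleftrightarrow> (\<forall>s. \<exists>a. \<pi> s = return_pmf a)"

definition neighbor :: "('s, 'a) policy \<Rightarrow> 's \<Rightarrow> 'a \<Rightarrow> ('s, 'a) policy" where
  "neighbor \<pi> s a = \<pi>(s := return_pmf a)"

text \<open>
  A trajectory is a sequence of triples \<open>(s, a\<^sub>1, a\<^sub>2)\<close>, indexed from 0: entry \<open>t\<close> is what is
  usually written with time index \<open>t + 1\<close>. Given the state, the agents draw their actions
  independently of each other. The law of the trajectory is the Ionescu-Tulcea measure of
  the kernels below, where kernel \<open>n\<close> maps the history \<open>\<omega> 0, \<dots>, \<omega> (n - 1)\<close> to the law
  of entry \<open>n\<close>.
\<close>

definition draw_actions ::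
    "('s, 'a1) policy \<Rightarrow> ('s, 'a2) policy \<Rightarrow> 's \<Rightarrow> ('s \<times> 'a1 \<times> 'a2) pmf" where
  "draw_actions \<pi>1 \<pi>2 s =
     map_pmf (\<lambda>(a1, a2). (s, a1, a2)) (pair_pmf (\<pi>1 s) (\<pi>2 s))"

definition step_pmf ::
    "('s, 'a1, 'a2) two_agent_mdp \<Rightarrow> 's pmf \<Rightarrow> ('s, 'a1) policy \<Rightarrow> ('s, 'a2) policy
     \<Rightarrow> nat \<Rightarrow> (nat \<Rightarrow> 's \<times> 'a1 \<times> 'a2) \<Rightarrow> ('s \<times> 'a1 \<times> 'a2) pmf" where
  "step_pmf M d \<pi>1 \<pi>2 n \<omega> =
     bind_pmf (if n = 0 then d else case \<omega> (n - 1) of (s, a1, a2) \<Rightarrow> trans M s a1 a2)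
       (draw_actions \<pi>1 \<pi>2)"

definition trajectories ::
    "('s, 'a1, 'a2) two_agent_mdp \<Rightarrow> 's pmf \<Rightarrow> ('s, 'a1) policy \<Rightarrow> ('s, 'a2) policy
     \<Rightarrow> (nat \<Rightarrow> 's \<times> 'a1 \<times> 'a2) measure" where
  "trajectories M d \<pi>1 \<pi>2 =
     projective_family.lim UNIV
       (Ionescu_Tulcea.CI (\<lambda>n \<omega>. measure_pmf (step_pmf M d \<pi>1 \<pi>2 n \<omega>)) (\<lambda>_. count_space UNIV))
       (\<lambda>_. count_space UNIV)"

lemma Ionescu_Tulcea_step:
  fixes M :: "('s::finite, 'a1::finite, 'a2::finite) two_agent_mdp"
  shows "Ionescu_Tulcea (\<lambda>n \<omega>. measure_pmf (step_pmf M d \<pi>1 \<pi>2 n \<omega>)) (\<lambda>_. count_space UNIV)"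
proof (rule Ionescu_Tulcea.intro)
  fix n
  show "(\<lambda>\<omega>. measure_pmf (step_pmf M d \<pi>1 \<pi>2 n \<omega>))
      \<in> measurable (PiM {0..<n} (\<lambda>_. count_space UNIV)) (subprob_algebra (count_space UNIV))"
  proof (cases n)
    case 0
    then show ?thesis
      by (auto simp: step_pmf_def space_subprob_algebra intro!: measurable_const prob_space_imp_subprob_space
          measure_pmf.prob_space_axioms)
  next
    case (Suc m)
    define g where "g = (\<lambda>(s, a1, a2). measure_pmf (bind_pmf (trans M s a1 a2) (draw_actions \<pi>1 \<pi>2)))"
    have "(\<lambda>\<omega>. \<omega> m) \<in> measurable (PiM {0..<n} (\<lambda>_. count_space (UNIV :: ('s \<times> 'a1 \<times> 'a2) set)))
        (count_space UNIV)"
      using Suc by (intro measurable_component_singleton) auto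
    moreover have "g \<in> measurable (count_space UNIV) (subprob_algebra (count_space UNIV))"
      by (auto simp: g_def space_subprob_algebra
          intro!: prob_space_imp_subprob_space measure_pmf.prob_space_axioms)
    ultimately have "(\<lambda>\<omega>. g (\<omega> m)) \<in> measurable (PiM {0..<n} (\<lambda>_. count_space UNIV))
        (subprob_algebra (count_space UNIV))"
      by (rule measurable_compose)
    then show ?thesis
      using Suc by (simp add: step_pmf_def g_def case_prod_beta)
  qed
qed (rule measure_pmf.prob_space_axioms)

text \<open>Not used in the definitions below: confirms that the measure has the intended
  finite-dimensional laws.\<close>

lemma trajectories_cylinder:
  fixes M :: "('s::finite, 'a1::finite, 'a2::finite) two_agent_mdp"
  shows "measure (trajectories M d \<pi>1 \<pi>2) {\<omega>. \<forall>i<n. \<omega> i = x i} =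
    (\<Prod>i<n. pmf (step_pmf M d \<pi>1 \<pi>2 i x) (x i))"
proof -
  let ?K = "\<lambda>n \<omega>. measure_pmf (step_pmf M d \<pi>1 \<pi>2 n \<omega>)"
  let ?N = "\<lambda>_::nat. count_space (UNIV :: ('s \<times> 'a1 \<times> 'a2) set)"
  interpret IT: Ionescu_Tulcea ?K ?N
    by (rule Ionescu_Tulcea_step)
  have sets: "{restrict x {0..<n}} \<in> sets (PiM {0..<n} ?N)" for n
  proof -
    have "{restrict x {0..<n}} = PiE {0..<n} (\<lambda>i. {x i})"
      by (auto simp: PiE_iff extensional_def fun_eq_iff)
    then show ?thesis
      by (auto intro!: sets_PiM_I_finite)
  qed
  have C: "emeasure (IT.C 0 n (\<lambda>_. undefined)) {restrict x {0..<n}} =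
      (\<Prod>i<n. ennreal (pmf (step_pmf M d \<pi>1 \<pi>2 i x) (x i)))" for n
  proof (induction n)
    case 0
    then show ?case
      by (auto simp: emeasure_return sets_PiM_empty PiM_empty restrict_def)
  next
    case (Suc n)
    have eP: "emeasure (IT.eP n \<omega>) {restrict x {0..<Suc n}} =
        ennreal (pmf (step_pmf M d \<pi>1 \<pi>2 n x) (x n)) * indicator {restrict x {0..<n}} \<omega>"
      if \<omega>: "\<omega> \<in> space (PiM {0..<n} ?N)" for \<omega>
    proof -
      have ext: "\<omega> i = undefined" if "i \<ge> n" for i
        using \<omega> that by (auto simp: space_PiM PiE_iff extensional_def)
      have upd: "fun_upd \<omega> n y = restrict x {0..<Suc n} \<longleftrightarrow> y = x n \<and> \<omega> = restrict x {0..<n}" for y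
      proof
        assume "fun_upd \<omega> n y = restrict x {0..<Suc n}"
        then have e: "fun_upd \<omega> n y i = restrict x {0..<Suc n} i" for i
          by simp
        have "\<omega> i = restrict x {0..<n} i" for i
          using e[of i] ext[of i] by (cases "i < n") (auto simp: fun_upd_def split: if_splits)
        with e[of n] show "y = x n \<and> \<omega> = restrict x {0..<n}"
          by auto
      qed (auto simp: fun_eq_iff)
      have st: "step_pmf M d \<pi>1 \<pi>2 n (restrict x {0..<n}) = step_pmf M d \<pi>1 \<pi>2 n x"
        by (auto simp: step_pmf_def)
      show ?thesis
      proof (cases "\<omega> = restrict x {0..<n}")
        case True
        then have "(\<lambda>y. fun_upd \<omega> n y) -` {restrict x {0..<Suc n}} \<inter> space (?N n) = {x n}"
          using upd by auto
        with True show ?thesis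
          using IT.emeasure_eP[OF \<omega> sets[of "Suc n"]] by (simp add: st emeasure_pmf_single)
      next
        case False
        then have "(\<lambda>y. fun_upd \<omega> n y) -` {restrict x {0..<Suc n}} \<inter> space (?N n) = {}"
          using upd by auto
        with False show ?thesis
          using IT.emeasure_eP[OF \<omega> sets[of "Suc n"]] by simp
      qed
    qed
    have sp: "(\<lambda>_. undefined) \<in> space (PiM {0..<0} ?N)"
      by (simp add: space_PiM)
    have "emeasure (IT.C 0 (Suc n) (\<lambda>_. undefined)) {restrict x {0..<Suc n}} =
        (\<integral>\<^sup>+\<omega>. emeasure (IT.eP n \<omega>) {restrict x {0..<Suc n}} \<partial>IT.C 0 n (\<lambda>_. undefined))"
      using IT.prob_space_C[OF sp, THEN prob_space.not_empty, of n]
        IT.measurable_eP[of n] sets[of "Suc n"] IT.sets_C[OF sp, of n]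
      by (subst IT.C.simps, subst emeasure_bind[where N="PiM {0..<Suc n} ?N"])
        (auto cong: measurable_cong_sets)
    also have "\<dots> = (\<integral>\<^sup>+\<omega>. ennreal (pmf (step_pmf M d \<pi>1 \<pi>2 n x) (x n)) *
        indicator {restrict x {0..<n}} \<omega> \<partial>IT.C 0 n (\<lambda>_. undefined))"
      using IT.space_C[OF sp, of n] by (intro nn_integral_cong eP) auto
    also have "\<dots> = ennreal (pmf (step_pmf M d \<pi>1 \<pi>2 n x) (x n)) *
        emeasure (IT.C 0 n (\<lambda>_. undefined)) {restrict x {0..<n}}"
      using IT.sets_C[OF sp, of n] sets[of n] by (intro nn_integral_cmult_indicator) auto
    finally show ?case
      unfolding Suc.IH by (simp del: restrict_apply IT.C.simps add: mult.commute)
  qed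
  have "{\<omega>. \<forall>i<n. \<omega> i = x i} = prod_emb UNIV ?N {0..<n} {restrict x {0..<n}}"
  proof -
    have "(\<forall>i<n. \<omega> i = x i) \<longleftrightarrow> restrict \<omega> {0..<n} = restrict x {0..<n}" for \<omega>
      by (metis (no_types, lifting) atLeastLessThan_iff le0 restrict_apply restrict_ext)
    then show ?thesis
      by (simp add: prod_emb_def space_PiM vimage_def)
  qed
  then have "emeasure (trajectories M d \<pi>1 \<pi>2) {\<omega>. \<forall>i<n. \<omega> i = x i} =
      emeasure (IT.C 0 n (\<lambda>_. undefined)) {restrict x {0..<n}}"
    using IT.lim[OF _ sets[of n]] IT.emeasure_CI[OF order_refl sets[of n]]
    by (simp add: trajectories_def prod_emb_id[of "{restrict x {0..<n}}"] PiE_iff del: restrict_apply)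
  then show ?thesis
    by (simp add: C measure_def prod_ennreal prod_nonneg)
qed

definition discounted_return ::
    "('s, 'a1, 'a2) two_agent_mdp \<Rightarrow> (nat \<Rightarrow> 's \<times> 'a1 \<times> 'a2) \<Rightarrow> real" where
  "discounted_return M \<omega> = (\<Sum>t. discount M ^ t * (case \<omega> t of (s, a1, a2) \<Rightarrow> reward2 M s a1 a2))"

definition score ::
    "('s, 'a1, 'a2) two_agent_mdp \<Rightarrow> ('s, 'a1) policy \<Rightarrow> ('s, 'a2) policy \<Rightarrow> real" where
  "score M \<pi>1 \<pi>2 =
     (1 - discount M) * (\<integral>\<omega>. discounted_return M \<omega> \<partial>trajectories M (init_dist M) \<pi>1 \<pi>2)"

definition occupancy ::
    "('s, 'a1, 'a2) two_agent_mdp \<Rightarrow> ('s, 'a1) policy \<Rightarrow> ('s, 'a2) policy \<Rightarrow> 's \<Rightarrow> real" where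
  "occupancy M \<pi>1 \<pi>2 s =
     (1 - discount M) *
     (\<integral>\<omega>. (\<Sum>t. discount M ^ t * of_bool (fst (\<omega> t) = s)) \<partial>trajectories M (init_dist M) \<pi>1 \<pi>2)"

text \<open>
  Conditioning on the first state being \<open>s\<close> means starting in \<open>s\<close>; this also makes sense for
  states of initial probability 0.
\<close>

definition val ::
    "('s, 'a1, 'a2) two_agent_mdp \<Rightarrow> ('s, 'a1) policy \<Rightarrow> ('s, 'a2) policy \<Rightarrow> 's \<Rightarrow> real" where
  "val M \<pi>1 \<pi>2 s = (\<integral>\<omega>. discounted_return M \<omega> \<partial>trajectories M (return_pmf s) \<pi>1 \<pi>2)"

definition target_class ::
    "('s, 'a1, 'a2) two_agent_mdp \<Rightarrow> ('s, 'a2) policy \<Rightarrow> ('s, 'a1) policy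
     \<Rightarrow> ('s, 'a2) policy set" where
  "target_class M \<pi>2t \<pi>1 = {\<pi>2. \<forall>s. occupancy M \<pi>1 \<pi>2t s > 0 \<longrightarrow> \<pi>2 s = \<pi>2t s}"

definition attack_feasible ::
    "('s, 'a1, 'a2) two_agent_mdp \<Rightarrow> ('s, 'a2) policy \<Rightarrow> real \<Rightarrow> ('s, 'a1) policy \<Rightarrow> bool" where
  "attack_feasible M \<pi>2t \<epsilon> \<pi>1 \<longleftrightarrow>
     (\<forall>\<pi>2 \<in> {\<pi>2. deterministic \<pi>2} - target_class M \<pi>2t \<pi>1.
        score M \<pi>1 \<pi>2t \<ge> score M \<pi>1 \<pi>2 + \<epsilon>)"

definition cost :: "real \<Rightarrow> ('s::finite, 'a::finite) policy \<Rightarrow> ('s, 'a) policy \<Rightarrow> real" where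
  "cost p \<pi> \<pi>0 = (\<Sum>s\<in>UNIV. (\<Sum>a\<in>UNIV. \<bar>pmf (\<pi> s) a - pmf (\<pi>0 s) a\<bar>) powr p) powr (1 / p)"

definition chi_bar ::
    "('s, 'a1, 'a2) two_agent_mdp \<Rightarrow> ('s, 'a1) policy \<Rightarrow> ('s, 'a2) policy \<Rightarrow> real
     \<Rightarrow> 's \<Rightarrow> 'a2 \<Rightarrow> real" where
  "chi_bar M \<pi>10 \<pi>2t \<epsilon>' s a2 =
     (if (\<forall>\<pi>1. occupancy M \<pi>1 \<pi>2t s > 0) \<and> pmf (\<pi>2t s) a2 = 0
      then max 0 ((score M \<pi>10 (neighbor \<pi>2t s a2) - score M \<pi>10 \<pi>2t + \<epsilon>')
                    / occupancy M \<pi>10 (neighbor \<pi>2t s a2) s)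
      else 0)"

definition max_norm :: "('i::finite \<Rightarrow> real) \<Rightarrow> real" where
  "max_norm f = Max (range (\<lambda>i. \<bar>f i\<bar>))"

end

theory Submission
  imports Defs
begin

text \<open>
  By the performance difference identity, switching the target policy to \<open>a\<close> at the single
  state \<open>s\<close> changes the score by the occupancy of \<open>s\<close> under the neighbor policy times the
  advantage of \<open>a\<close> at \<open>s\<close>. Hence the relevant entries of \<open>chi_bar\<close> are positive parts of
  advantages under \<open>\<pi>10\<close>, and feasibility makes the same advantages nonpositive under \<open>\<pi>1\<close>.
  If the policies of agent 1 differ by at most \<open>\<delta>\<close> in every state, then \<open>V(s)\<close> and \<open>Q(s, a)\<close>
  each move by at most \<open>\<delta> (\<parallel>R\<parallel> + \<gamma> \<parallel>V\<parallel>) / (1 - \<gamma>)\<close>, so an advantage moves by at most twice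
  that amount; the cost bounds \<open>\<delta>\<close>.
\<close>

section \<open>Expectations and maximum norms over finite types\<close>

abbreviation (input) expect :: "'a pmf \<Rightarrow> ('a \<Rightarrow> real) \<Rightarrow> real" where
  "expect \<equiv> measure_pmf.expectation"

lemma integrable_pmf_finite_type [simp]:
  fixes p :: "'a::finite pmf" and f :: "'a \<Rightarrow> real"
  shows "integrable (measure_pmf p) f"
  by (rule integrable_measure_pmf_finite) simp

lemma expect_eq_sum:
  fixes p :: "'a::finite pmf"
  shows "expect p f = (\<Sum>x\<in>UNIV. pmf p x * f x)"
  by (subst integral_measure_pmf[of UNIV]) auto

lemma expect_bind:
  fixes p :: "'a::finite pmf" and q :: "'a \<Rightarrow> 'b::finite pmf"
  shows "expect (bind_pmf p q) f = expect p (\<lambda>x. expect (q x) f)"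
  by (subst pmf_expectation_bind[of UNIV]) (auto simp: expect_eq_sum[of p])

lemma expect_abs_bound:
  fixes p :: "'a::finite pmf"
  assumes "\<And>x. \<bar>f x\<bar> \<le> C"
  shows "\<bar>expect p f\<bar> \<le> C"
proof -
  have "\<bar>expect p f\<bar> \<le> expect p (\<lambda>x. \<bar>f x\<bar>)"
    by (rule integral_abs_bound)
  also have "\<dots> \<le> expect p (\<lambda>_. C)"
    using assms by (intro integral_mono) auto
  finally show ?thesis
    by simp
qed

lemma expect_diff_le:
  fixes p q :: "'a::finite pmf"
  assumes "\<And>x. \<bar>f x\<bar> \<le> C"
  shows "\<bar>expect p f - expect q f\<bar> \<le> (\<Sum>x\<in>UNIV. \<bar>pmf p x - pmf q x\<bar>) * C"
proof -
  have "\<bar>expect p f - expect q f\<bar> = \<bar>\<Sum>x\<in>UNIV. (pmf p x - pmf q x) * f x\<bar>"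
    by (simp add: expect_eq_sum sum_subtractf left_diff_distrib)
  also have "\<dots> \<le> (\<Sum>x\<in>UNIV. \<bar>(pmf p x - pmf q x) * f x\<bar>)"
    by (rule sum_abs)
  also have "\<dots> \<le> (\<Sum>x\<in>UNIV. \<bar>pmf p x - pmf q x\<bar> * C)"
    using assms by (intro sum_mono) (auto simp: abs_mult intro!: mult_left_mono)
  finally show ?thesis
    by (simp add: sum_distrib_right)
qed

lemma abs_le_max_norm: "\<bar>f i\<bar> \<le> max_norm f"
  by (auto simp: max_norm_def)

lemma max_norm_le: "(\<And>i. \<bar>f i\<bar> \<le> C) \<Longrightarrow> max_norm f \<le> C"
  by (auto simp: max_norm_def)

lemma max_norm_nonneg: "0 \<le> max_norm f"
  using abs_le_max_norm[of f undefined] by linarith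

text \<open>An expectation of \<open>u\<close> is at most its maximum norm, so that norm is bounded
  by \<open>c\<close> plus \<gamma> times itself. With \<open>c = 0\<close> this gives uniqueness of
  discounted fixed points, with general \<open>c\<close> their stability.\<close>

lemma discounted_fixpoint_bound:
  fixes p :: "'s::finite \<Rightarrow> 's pmf"
  assumes "0 \<le> \<gamma>" "\<gamma> < 1" and u: "\<And>s. \<bar>u s\<bar> \<le> c + \<gamma> * \<bar>expect (p s) u\<bar>"
  shows "\<bar>u s\<bar> \<le> c / (1 - \<gamma>)"
proof -
  have "max_norm u \<le> c + \<gamma> * max_norm u"
  proof (rule max_norm_le)
    fix s
    have "\<gamma> * \<bar>expect (p s) u\<bar> \<le> \<gamma> * max_norm u"
      by (intro mult_left_mono expect_abs_bound abs_le_max_norm assms)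
    with u[of s] show "\<bar>u s\<bar> \<le> c + \<gamma> * max_norm u"
      by linarith
  qed
  then have "max_norm u \<le> c / (1 - \<gamma>)"
    using assms by (simp add: field_simps)
  with abs_le_max_norm[of u s] show ?thesis
    by linarith
qed

section \<open>One-dimensional laws of the trajectory\<close>

definition next_state ::
    "('s, 'a1, 'a2) two_agent_mdp \<Rightarrow> ('s, 'a1) policy \<Rightarrow> ('s, 'a2) policy \<Rightarrow> 's \<Rightarrow> 's pmf" where
  "next_state M \<pi>1 \<pi>2 s = bind_pmf (draw_actions \<pi>1 \<pi>2 s) (\<lambda>(s, a1, a2). trans M s a1 a2)"

primrec state_law ::
    "('s, 'a1, 'a2) two_agent_mdp \<Rightarrow> ('s, 'a1) policy \<Rightarrow> ('s, 'a2) policy \<Rightarrow> nat \<Rightarrow> 's pmf \<Rightarrow> 's pmf" where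
  "state_law M \<pi>1 \<pi>2 0 d = d"
| "state_law M \<pi>1 \<pi>2 (Suc n) d = bind_pmf (state_law M \<pi>1 \<pi>2 n d) (next_state M \<pi>1 \<pi>2)"

lemma state_law_bind:
  "state_law M \<pi>1 \<pi>2 n (bind_pmf d k) = bind_pmf d (\<lambda>s. state_law M \<pi>1 \<pi>2 n (k s))"
  by (induction n) (simp_all add: bind_assoc_pmf)

text \<open>The recursion appends the last transition; the Bellman equation needs the first one
  split off.\<close>

lemma state_law_Suc_shift:
  "state_law M \<pi>1 \<pi>2 (Suc n) d = state_law M \<pi>1 \<pi>2 n (bind_pmf d (next_state M \<pi>1 \<pi>2))"
  by (induction n) simp_all

lemma sets_trajectories:
  fixes M :: "('s::finite, 'a1::finite, 'a2::finite) two_agent_mdp"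
  shows "sets (trajectories M d \<pi>1 \<pi>2) = sets (PiM UNIV (\<lambda>_. count_space UNIV))"
proof -
  interpret Ionescu_Tulcea "\<lambda>n \<omega>. measure_pmf (step_pmf M d \<pi>1 \<pi>2 n \<omega>)" "\<lambda>_. count_space UNIV"
    by (rule Ionescu_Tulcea_step)
  show ?thesis
    unfolding trajectories_def by (rule PF.sets_lim)
qed

lemma space_trajectories:
  fixes M :: "('s::finite, 'a1::finite, 'a2::finite) two_agent_mdp"
  shows "space (trajectories M d \<pi>1 \<pi>2) = UNIV"
  using sets_eq_imp_space_eq[OF sets_trajectories[of M d \<pi>1 \<pi>2]] by (simp add: space_PiM)

lemma prob_space_trajectories:
  fixes M :: "('s::finite, 'a1::finite, 'a2::finite) two_agent_mdp"
  shows "prob_space (trajectories M d \<pi>1 \<pi>2)"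
proof
  \<comment> \<open>The cylinder over the empty history is the whole space, and its product is
    empty.\<close>
  have "measure (trajectories M d \<pi>1 \<pi>2) UNIV = 1"
    using trajectories_cylinder[of M d \<pi>1 \<pi>2 0] by simp
  then show "emeasure (trajectories M d \<pi>1 \<pi>2) (space (trajectories M d \<pi>1 \<pi>2)) = 1"
    by (metis space_trajectories emeasure_eq_ennreal_measure ennreal_1 measure_zero_top zero_neq_one)
qed

lemma measurable_trajectories_component [measurable]:
  fixes M :: "('s::finite, 'a1::finite, 'a2::finite) two_agent_mdp"
  shows "(\<lambda>\<omega>. \<omega> t) \<in> measurable (trajectories M d \<pi>1 \<pi>2) (count_space UNIV)"
proof -
  have "(\<lambda>\<omega>. \<omega> t) \<in> measurable (PiM UNIV (\<lambda>_. count_space (UNIV :: ('s \<times> 'a1 \<times> 'a2) set))) (count_space UNIV)"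
    by (rule measurable_component_singleton) simp
  then show ?thesis
    by (simp cong: measurable_cong_sets add: measurable_cong_sets[OF sets_trajectories refl])
qed

lemma measurable_trajectories_cylinder:
  fixes M :: "('s::finite, 'a1::finite, 'a2::finite) two_agent_mdp"
  shows "{\<omega>. \<forall>i<n. \<omega> i = x i} \<in> sets (trajectories M d \<pi>1 \<pi>2)"
proof -
  have "{\<omega> \<in> space (trajectories M d \<pi>1 \<pi>2). \<forall>i<n. \<omega> i = x i} \<in> sets (trajectories M d \<pi>1 \<pi>2)"
    by measurable
  then show ?thesis
    by (simp add: space_trajectories)
qed

text \<open>The cylinder formula needs all entries from 0 on prescribed, but here only entries
  \<open>n\<close> to \<open>m - 1\<close> are. Splitting \<open>A\<close> by the finitely many
  histories of length \<open>n\<close> makes it a disjoint union of full cylinders; extensional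
  functions count each history once.\<close>

lemma measure_trajectories_sum_histories:
  fixes M :: "('s::finite, 'a1::finite, 'a2::finite) two_agent_mdp"
  assumes A: "\<And>\<omega>. \<omega> \<in> A \<longleftrightarrow> (\<forall>i\<in>{n..<m}. \<omega> i = y i)" and "n \<le> m"
  shows "measure (trajectories M d \<pi>1 \<pi>2) A =
    (\<Sum>x\<in>PiE {..<n} (\<lambda>_. UNIV). \<Prod>i<m.
       let z = (\<lambda>i. if i < n then x i else y i) in pmf (step_pmf M d \<pi>1 \<pi>2 i z) (z i))"
proof -
  interpret prob_space "trajectories M d \<pi>1 \<pi>2"
    by (rule prob_space_trajectories)
  let ?z = "\<lambda>x i. if i < n then x i else y i"
  let ?B = "\<lambda>x. {\<omega>. \<forall>i<m. \<omega> i = ?z x i}"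
  have union: "A = (\<Union>x\<in>PiE {..<n} (\<lambda>_. UNIV). ?B x)"
  proof (intro set_eqI iffI)
    fix \<omega> assume "\<omega> \<in> A"
    then have "restrict \<omega> {..<n} \<in> PiE {..<n} (\<lambda>_. UNIV)" "\<omega> \<in> ?B (restrict \<omega> {..<n})"
      using A by auto
    then show "\<omega> \<in> (\<Union>x\<in>PiE {..<n} (\<lambda>_. UNIV). ?B x)"
      by blast
  next
    fix \<omega> assume "\<omega> \<in> (\<Union>x\<in>PiE {..<n} (\<lambda>_. UNIV). ?B x)"
    then obtain x where "\<omega> \<in> ?B x"
      by blast
    then show "\<omega> \<in> A"
      unfolding A by auto
  qed
  have disj: "disjoint_family_on ?B (PiE {..<n} (\<lambda>_. UNIV))"
    unfolding disjoint_family_on_def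
  proof (intro ballI impI)
    fix x x' :: "nat \<Rightarrow> 's \<times> 'a1 \<times> 'a2"
    assume x: "x \<in> PiE {..<n} (\<lambda>_. UNIV)" "x' \<in> PiE {..<n} (\<lambda>_. UNIV)" and "x \<noteq> x'"
    then obtain i where i: "i < n" "x i \<noteq> x' i"
      using PiE_ext[OF x] by auto
    have mem: "\<omega> i = z i" if "\<omega> \<in> ?B z" for \<omega> z
    proof -
      have "\<forall>j<m. \<omega> j = ?z z j"
        using that by (rule CollectD)
      then have "\<omega> i = ?z z i"
        using i(1) \<open>n \<le> m\<close> by (blast intro: less_le_trans)
      then show ?thesis
        using i(1) by simp
    qed
    show "?B x \<inter> ?B x' = {}"
    proof (rule equals0I)
      fix \<omega> assume "\<omega> \<in> ?B x \<inter> ?B x'"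
      then have "x i = x' i"
        using mem[of \<omega> x] mem[of \<omega> x'] by (elim IntE) metis
      with i(2) show False
        by contradiction
    qed
  qed
  have "measure (trajectories M d \<pi>1 \<pi>2) A =
      (\<Sum>x\<in>PiE {..<n} (\<lambda>_. UNIV). measure (trajectories M d \<pi>1 \<pi>2) (?B x))"
    unfolding union
    by (intro finite_measure_finite_Union disj image_subsetI measurable_trajectories_cylinder)
      (simp add: finite_PiE)
  then show ?thesis
    by (simp add: trajectories_cylinder Let_def)
qed

text \<open>Induction through the Markov property: the kernel for entry \<open>Suc n\<close> reads
  only entry \<open>n\<close>, so the joint law of the two entries factorises.\<close>

lemma measure_trajectories_component:
  fixes M :: "('s::finite, 'a1::finite, 'a2::finite) two_agent_mdp"
  shows "measure (trajectories M d \<pi>1 \<pi>2) {\<omega>. \<omega> n = y} =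
    pmf (bind_pmf (state_law M \<pi>1 \<pi>2 n d) (draw_actions \<pi>1 \<pi>2)) y"
proof (induction n arbitrary: y)
  case 0
  show ?case
    using trajectories_cylinder[of M d \<pi>1 \<pi>2 1 "\<lambda>_. y"] by (simp add: step_pmf_def)
next
  case (Suc n)
  let ?T = "trajectories M d \<pi>1 \<pi>2"
  interpret prob_space ?T
    by (rule prob_space_trajectories)
  let ?k = "\<lambda>z. bind_pmf (case z of (s, a1, a2) \<Rightarrow> trans M s a1 a2) (draw_actions \<pi>1 \<pi>2)"
  have pair: "measure ?T {\<omega>. \<omega> n = z \<and> \<omega> (Suc n) = y} = measure ?T {\<omega>. \<omega> n = z} * pmf (?k z) y" for z
  proof -
    have 1: "measure ?T {\<omega>. \<omega> n = z \<and> \<omega> (Suc n) = y} =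
      (\<Sum>x\<in>PiE {..<n} (\<lambda>_. UNIV). \<Prod>i<Suc (Suc n).
        let z = (\<lambda>i. if i < n then x i else ((\<lambda>_. y)(n := z)) i) in pmf (step_pmf M d \<pi>1 \<pi>2 i z) (z i))"
      by (rule measure_trajectories_sum_histories) (auto simp: le_less_Suc_eq less_Suc_eq)
    have 2: "measure ?T {\<omega>. \<omega> n = z} =
      (\<Sum>x\<in>PiE {..<n} (\<lambda>_. UNIV). \<Prod>i<Suc n.
        let z = (\<lambda>i. if i < n then x i else ((\<lambda>_. y)(n := z)) i) in pmf (step_pmf M d \<pi>1 \<pi>2 i z) (z i))"
      by (rule measure_trajectories_sum_histories) auto
    \<comment> \<open>Both sums run over the same histories, and the products differ only in the
      last factor, where the kernel sees only the entry \<open>z\<close>.\<close>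
    show ?thesis
      unfolding 1 2 sum_distrib_right
      by (intro sum.cong refl, subst prod.lessThan_Suc) (simp add: Let_def step_pmf_def)
  qed
  have "{\<omega>. \<omega> (Suc n) = y} = (\<Union>z\<in>UNIV. {\<omega>. \<omega> n = z \<and> \<omega> (Suc n) = y})"
    by auto
  moreover have "{\<omega> \<in> space ?T. \<omega> n = z \<and> \<omega> (Suc n) = y} \<in> sets ?T" for z
    by measurable
  ultimately have "measure ?T {\<omega>. \<omega> (Suc n) = y} = (\<Sum>z\<in>UNIV. measure ?T {\<omega>. \<omega> n = z \<and> \<omega> (Suc n) = y})"
    by (simp only:, intro finite_measure_finite_Union)
      (auto simp: space_trajectories disjoint_family_on_def)
  also have "\<dots> = pmf (bind_pmf (bind_pmf (state_law M \<pi>1 \<pi>2 n d) (draw_actions \<pi>1 \<pi>2)) ?k) y"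
    by (simp add: pair Suc.IH pmf_bind[of _ ?k] expect_eq_sum)
  also have "bind_pmf (bind_pmf (state_law M \<pi>1 \<pi>2 n d) (draw_actions \<pi>1 \<pi>2)) ?k =
      bind_pmf (state_law M \<pi>1 \<pi>2 (Suc n) d) (draw_actions \<pi>1 \<pi>2)"
    by (simp add: bind_assoc_pmf next_state_def case_prod_beta)
  finally show ?case .
qed

lemma integrable_trajectories_component:
  fixes M :: "('s::finite, 'a1::finite, 'a2::finite) two_agent_mdp" and f :: "'s \<times> 'a1 \<times> 'a2 \<Rightarrow> real"
  shows "integrable (trajectories M d \<pi>1 \<pi>2) (\<lambda>\<omega>. f (\<omega> t))"
proof -
  interpret prob_space "trajectories M d \<pi>1 \<pi>2"
    by (rule prob_space_trajectories)
  show ?thesis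
    by (rule integrable_const_bound[where B="max_norm f"]) (auto simp: abs_le_max_norm)
qed

lemma integral_trajectories_component:
  fixes M :: "('s::finite, 'a1::finite, 'a2::finite) two_agent_mdp"
  shows "(\<integral>\<omega>. f (\<omega> t) \<partial>trajectories M d \<pi>1 \<pi>2) =
    expect (bind_pmf (state_law M \<pi>1 \<pi>2 t d) (draw_actions \<pi>1 \<pi>2)) f"
proof -
  let ?T = "trajectories M d \<pi>1 \<pi>2"
  interpret prob_space ?T
    by (rule prob_space_trajectories)
  have sets: "{\<omega>. \<omega> t = y} \<in> sets ?T" for y
  proof -
    have "{\<omega> \<in> space ?T. \<omega> t = y} \<in> sets ?T"
      by measurable
    then show ?thesis
      by (simp add: space_trajectories)
  qed
  \<comment> \<open>Entries range over a finite type, so the integrand is a finite combination of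
    indicators.\<close>
  have "f (\<omega> t) = (\<Sum>y\<in>UNIV. indicator {\<omega>. \<omega> t = y} \<omega> * f y)" for \<omega>
    by (simp add: indicator_def if_distrib[of "\<lambda>x. x * _"] sum.delta cong: if_cong)
  then have "(\<integral>\<omega>. f (\<omega> t) \<partial>?T) = (\<integral>\<omega>. (\<Sum>y\<in>UNIV. indicator {\<omega>. \<omega> t = y} \<omega> * f y) \<partial>?T)"
    by simp
  also have "\<dots> = (\<Sum>y\<in>UNIV. measure ?T {\<omega>. \<omega> t = y} * f y)"
    using sets by (subst Bochner_Integration.integral_sum)
      (auto intro!: integrable_mult_left integrable_real_indicator simp: emeasure_eq_measure space_trajectories)
  finally show ?thesis
    by (simp add: measure_trajectories_component expect_eq_sum)
qed

section \<open>Discounted values\<close>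

text \<open>The payoff \<open>f\<close> is a parameter so that one theory covers both uses: the
  reward gives scores and values, the indicator of a state gives its unnormalised occupancy.\<close>

definition disc_value ::
    "('s, 'a1, 'a2) two_agent_mdp \<Rightarrow> ('s, 'a1) policy \<Rightarrow> ('s, 'a2) policy
     \<Rightarrow> ('s \<times> 'a1 \<times> 'a2 \<Rightarrow> real) \<Rightarrow> 's pmf \<Rightarrow> real" where
  "disc_value M \<pi>1 \<pi>2 f d = (\<integral>\<omega>. (\<Sum>t. discount M ^ t * f (\<omega> t)) \<partial>trajectories M d \<pi>1 \<pi>2)"

definition state_value ::
    "('s, 'a1, 'a2) two_agent_mdp \<Rightarrow> ('s, 'a1) policy \<Rightarrow> ('s, 'a2) policy
     \<Rightarrow> ('s \<times> 'a1 \<times> 'a2 \<Rightarrow> real) \<Rightarrow> 's \<Rightarrow> real" where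
  "state_value M \<pi>1 \<pi>2 f s = disc_value M \<pi>1 \<pi>2 f (return_pmf s)"

text \<open>The continuation \<open>W\<close> is not tied to the policies: with \<open>W\<close> the
  value of one policy and a neighbor of it in the first step, this is an action value Q(s,
  a).\<close>

definition backup ::
    "('s, 'a1, 'a2) two_agent_mdp \<Rightarrow> ('s, 'a1) policy \<Rightarrow> ('s, 'a2) policy
     \<Rightarrow> ('s \<times> 'a1 \<times> 'a2 \<Rightarrow> real) \<Rightarrow> ('s \<Rightarrow> real) \<Rightarrow> 's \<Rightarrow> real" where
  "backup M \<pi>1 \<pi>2 f W s = expect (draw_actions \<pi>1 \<pi>2 s) f + discount M * expect (next_state M \<pi>1 \<pi>2 s) W"

context
  fixes M :: "('s::finite, 'a1::finite, 'a2::finite) two_agent_mdp"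
  assumes discount: "0 \<le> discount M" "discount M < 1"
begin

text \<open>A geometric series of ratio \<gamma>, scaled by \<open>max_norm f\<close>, dominates the
  terms, so sum and expectation commute; then only the laws of single entries matter.\<close>

lemma disc_value_sums:
  "(\<lambda>t. discount M ^ t * expect (state_law M \<pi>1 \<pi>2 t d) (\<lambda>s. expect (draw_actions \<pi>1 \<pi>2 s) f))
     sums disc_value M \<pi>1 \<pi>2 f d"
proof -
  let ?T = "trajectories M d \<pi>1 \<pi>2"
  interpret prob_space ?T
    by (rule prob_space_trajectories)
  let ?g = "\<lambda>t \<omega>. discount M ^ t * f (\<omega> t)"
  have geo: "summable (\<lambda>t. discount M ^ t * max_norm f)"
    using discount by (intro summable_mult2 summable_geometric) auto
  have b: "norm (?g t \<omega>) \<le> discount M ^ t * max_norm f" for t \<omega>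
    using discount by (auto simp: abs_mult intro!: mult_left_mono abs_le_max_norm)
  have int: "integrable ?T (?g t)" for t
    by (intro integrable_mult_right integrable_trajectories_component)
  have ae: "AE \<omega> in ?T. summable (\<lambda>t. norm (?g t \<omega>))"
    using b by (intro AE_I2 summable_comparison_test'[OF geo, of 0]) auto
  have "(\<integral>\<omega>. norm (?g t \<omega>) \<partial>?T) \<le> discount M ^ t * max_norm f" for t
  proof -
    have "(\<integral>\<omega>. norm (?g t \<omega>) \<partial>?T) \<le> (\<integral>\<omega>. discount M ^ t * max_norm f \<partial>?T)"
      using int b by (intro integral_mono) auto
    then show ?thesis
      by (simp add: prob_space)
  qed
  then have sm: "summable (\<lambda>t. \<integral>\<omega>. norm (?g t \<omega>) \<partial>?T)"
    by (intro summable_comparison_test'[OF geo, of 0]) auto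
  have "(\<lambda>t. \<integral>\<omega>. ?g t \<omega> \<partial>?T) sums disc_value M \<pi>1 \<pi>2 f d"
    unfolding disc_value_def by (rule sums_integral[OF int ae sm])
  then show ?thesis
    by (simp add: integral_trajectories_component expect_bind)
qed

text \<open>A distribution is a mixture of point masses, and every term of the series is linear in
  the initial distribution because \<open>state_law\<close> is.\<close>

lemma disc_value_linear: "disc_value M \<pi>1 \<pi>2 f d = expect d (state_value M \<pi>1 \<pi>2 f)"
proof (rule sums_unique2[OF disc_value_sums])
  have "state_law M \<pi>1 \<pi>2 t d = bind_pmf d (\<lambda>s. state_law M \<pi>1 \<pi>2 t (return_pmf s))" for t
    using state_law_bind[of M \<pi>1 \<pi>2 t d return_pmf] by (simp add: bind_return_pmf')
  then have "expect (state_law M \<pi>1 \<pi>2 t d) h = (\<Sum>s\<in>UNIV. pmf d s * expect (state_law M \<pi>1 \<pi>2 t (return_pmf s)) h)"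
    for t h
    using expect_bind expect_eq_sum[of d] by metis
  moreover have "(\<lambda>t. \<Sum>s\<in>UNIV. pmf d s * (discount M ^ t *
      expect (state_law M \<pi>1 \<pi>2 t (return_pmf s)) (\<lambda>s. expect (draw_actions \<pi>1 \<pi>2 s) f)))
     sums (\<Sum>s\<in>UNIV. pmf d s * disc_value M \<pi>1 \<pi>2 f (return_pmf s))"
    by (intro sums_sum sums_mult disc_value_sums)
  ultimately show "(\<lambda>t. discount M ^ t * expect (state_law M \<pi>1 \<pi>2 t d) (\<lambda>s. expect (draw_actions \<pi>1 \<pi>2 s) f))
     sums expect d (state_value M \<pi>1 \<pi>2 f)"
    by (simp add: expect_eq_sum[of d] sum_distrib_left mult.left_commute state_value_def)
qed

text \<open>Term 0 of the series is the immediate payoff; the others form \<gamma> times the series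
  started from the law of the next state.\<close>

lemma state_value_Bellman:
  "state_value M \<pi>1 \<pi>2 f s = backup M \<pi>1 \<pi>2 f (state_value M \<pi>1 \<pi>2 f) s"
  unfolding state_value_def[of _ _ _ _ s]
proof (rule sums_unique2[OF disc_value_sums])
  let ?a = "\<lambda>t d. discount M ^ t * expect (state_law M \<pi>1 \<pi>2 t d) (\<lambda>s. expect (draw_actions \<pi>1 \<pi>2 s) f)"
  have "(\<lambda>t. discount M * ?a t (next_state M \<pi>1 \<pi>2 s)) sums
      (discount M * disc_value M \<pi>1 \<pi>2 f (next_state M \<pi>1 \<pi>2 s))"
    by (intro sums_mult disc_value_sums)
  also have "(\<lambda>t. discount M * ?a t (next_state M \<pi>1 \<pi>2 s)) = (\<lambda>t. ?a (Suc t) (return_pmf s))"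
    by (simp add: state_law_Suc_shift bind_return_pmf mult.assoc del: state_law.simps)
  finally have "(\<lambda>t. ?a t (return_pmf s)) sums
      (discount M * disc_value M \<pi>1 \<pi>2 f (next_state M \<pi>1 \<pi>2 s) + ?a 0 (return_pmf s))"
    by (subst (asm) sums_Suc_iff) simp
  then show "(\<lambda>t. ?a t (return_pmf s)) sums backup M \<pi>1 \<pi>2 f (state_value M \<pi>1 \<pi>2 f) s"
    by (simp add: disc_value_linear backup_def add.commute)
qed

section \<open>Changing the policy of agent 2 at one state\<close>

text \<open>The performance difference identity: each discounted visit to \<open>s\<close> under the
  new policy contributes the advantage of \<open>q\<close> over \<open>\<pi>2\<close> at
  \<open>s\<close>.\<close>

lemma disc_value_change_at:
  assumes "\<pi>2' = \<pi>2(s := q)"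
  shows "disc_value M \<pi>1 \<pi>2' f d - disc_value M \<pi>1 \<pi>2 f d =
    disc_value M \<pi>1 \<pi>2' (\<lambda>x. of_bool (fst x = s)) d *
    (backup M \<pi>1 \<pi>2' f (state_value M \<pi>1 \<pi>2 f) s - state_value M \<pi>1 \<pi>2 f s)"
proof -
  define V V' N where "V = state_value M \<pi>1 \<pi>2 f" and "V' = state_value M \<pi>1 \<pi>2' f"
    and "N = state_value M \<pi>1 \<pi>2' (\<lambda>x. of_bool (fst x = s))"
  define A where "A = backup M \<pi>1 \<pi>2' f V s - V s"
  \<comment> \<open>The defect of the identity when the start is fixed at \<open>s'\<close>.\<close>
  define u where "u s' = V' s' - V s' - N s' * A" for s'
  let ?P = "next_state M \<pi>1 \<pi>2'"
  \<comment> \<open>Both sides solve the same linear fixed-point equation, which has a unique solution.\<close>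
  have u: "u s' = discount M * expect (?P s') u" for s'
  proof -
    have N: "N s' = of_bool (s' = s) + discount M * expect (?P s') N"
      unfolding N_def by (subst state_value_Bellman) (simp add: backup_def draw_actions_def case_prod_beta)
    \<comment> \<open>Away from \<open>s\<close> the policies agree, so \<open>V\<close> obeys the
      Bellman equation of the new policy there; at \<open>s\<close> it misses it by exactly
      \<open>A\<close>.\<close>
    have V: "V s' + of_bool (s' = s) * A = backup M \<pi>1 \<pi>2' f V s'"
    proof (cases "s' = s")
      case False
      then have "draw_actions \<pi>1 \<pi>2' s' = draw_actions \<pi>1 \<pi>2 s'"
        by (simp add: draw_actions_def assms)
      with False show ?thesis
        using state_value_Bellman[of \<pi>1 \<pi>2 f s'] by (simp add: V_def backup_def next_state_def)
    qed (simp add: A_def)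
    have E: "expect (?P s') u = expect (?P s') V' - expect (?P s') V - expect (?P s') N * A"
      unfolding u_def by simp
    have "u s' = V' s' - (V s' + of_bool (s' = s) * A) - (N s' - of_bool (s' = s)) * A"
      unfolding u_def by (simp add: algebra_simps)
    also have "V' s' = backup M \<pi>1 \<pi>2' f V' s'"
      unfolding V'_def by (rule state_value_Bellman)
    also have "N s' - of_bool (s' = s) = discount M * expect (?P s') N"
      using N by linarith
    finally show ?thesis
      unfolding V E by (simp add: backup_def algebra_simps)
  qed
  have "\<bar>u s'\<bar> \<le> 0 / (1 - discount M)" for s'
  proof (rule discounted_fixpoint_bound[OF discount, where p="?P"])
    fix s'
    show "\<bar>u s'\<bar> \<le> 0 + discount M * \<bar>expect (?P s') u\<bar>"
      using discount by (subst u) (simp add: abs_mult)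
  qed
  then have "V' s' - V s' = N s' * A" for s'
    by (simp add: u_def)
  then have "expect d (\<lambda>s'. V' s' - V s') = expect d (\<lambda>s'. N s' * A)"
    by simp
  then have "expect d V' - expect d V = expect d N * A"
    by simp
  then show ?thesis
    unfolding A_def V_def V'_def N_def by (simp only: disc_value_linear)
qed

text \<open>With the visits to \<open>s\<close> themselves as payoff, the right side of the identity
  vanishes. This carries positive occupancy of \<open>s\<close> from the target policy to its
  neighbor.\<close>

lemma disc_value_visits_change_at:
  assumes "\<pi>2' = \<pi>2(s := q)"
    and "disc_value M \<pi>1 \<pi>2' (\<lambda>x. of_bool (fst x = s)) d = 0"
  shows "disc_value M \<pi>1 \<pi>2 (\<lambda>x. of_bool (fst x = s)) d = 0"
  using disc_value_change_at[OF assms(1), of \<pi>1 "\<lambda>x. of_bool (fst x = s)" d]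
  unfolding assms(2) by linarith

section \<open>Changing the policy of agent 1\<close>

text \<open>Averaging over the action of agent 2 first leaves a function of \<open>a1\<close> still
  bounded by \<open>C\<close>.\<close>

lemma expect_draw_diff_le:
  fixes \<pi>1 \<pi>1' :: "('s, 'a1) policy" and \<pi>2 :: "('s, 'a2) policy"
  assumes "\<And>x. \<bar>f x\<bar> \<le> C"
  shows "\<bar>expect (draw_actions \<pi>1 \<pi>2 s) f - expect (draw_actions \<pi>1' \<pi>2 s) f\<bar>
    \<le> (\<Sum>a\<in>UNIV. \<bar>pmf (\<pi>1 s) a - pmf (\<pi>1' s) a\<bar>) * C"
proof -
  have "expect (draw_actions \<pi> \<pi>2 s) f = expect (\<pi> s) (\<lambda>a1. expect (\<pi>2 s) (\<lambda>a2. f (s, a1, a2)))"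
    for \<pi> :: "('s, 'a1) policy"
    by (simp add: draw_actions_def pair_pmf_def expect_bind case_prod_beta)
  then show ?thesis
    using assms by (auto intro!: expect_diff_le expect_abs_bound)
qed

context
  fixes \<pi>1 \<pi>1' :: "('s, 'a1) policy" and \<delta> :: real
  assumes dist: "\<And>s. (\<Sum>a\<in>UNIV. \<bar>pmf (\<pi>1 s) a - pmf (\<pi>1' s) a\<bar>) \<le> \<delta>"
begin

text \<open>Change the policy first and the continuation second. The policy change is measured on
  \<open>W'\<close>, so that the constant involves only the value under \<open>\<pi>1'\<close>,
  later the default policy.\<close>

lemma backup_diff_le:
  "\<bar>backup M \<pi>1 \<pi>2 f W s - backup M \<pi>1' \<pi>2 f W' s\<bar>
   \<le> \<delta> * (max_norm f + discount M * max_norm W') +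
     discount M * \<bar>expect (next_state M \<pi>1 \<pi>2 s) (\<lambda>s. W s - W' s)\<bar>"
proof -
  let ?C = "max_norm f + discount M * max_norm W'"
  \<comment> \<open>Immediate payoff plus discounted continuation, which makes a backup a single
    expectation over the action draw.\<close>
  define h where "h = (\<lambda>(s, a1, a2). f (s, a1, a2) + discount M * expect (trans M s a1 a2) W')"
  have h: "\<bar>h x\<bar> \<le> ?C" for x
  proof -
    obtain s a1 a2 where x: "x = (s, a1, a2)"
      by (cases x)
    have "\<bar>discount M * expect (trans M s a1 a2) W'\<bar> \<le> discount M * max_norm W'"
      using discount by (auto simp: abs_mult intro!: mult_left_mono expect_abs_bound abs_le_max_norm)
    then show ?thesis
      using abs_le_max_norm[of f x] by (simp add: x h_def)
  qed
  have backup: "backup M \<pi> \<pi>2 f W' s = expect (draw_actions \<pi> \<pi>2 s) h" for \<pi> :: "('s, 'a1) policy"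
    unfolding backup_def h_def next_state_def expect_bind by (simp add: case_prod_unfold)
  have "\<bar>backup M \<pi>1 \<pi>2 f W' s - backup M \<pi>1' \<pi>2 f W' s\<bar> \<le>
      (\<Sum>a\<in>UNIV. \<bar>pmf (\<pi>1 s) a - pmf (\<pi>1' s) a\<bar>) * ?C"
    unfolding backup by (rule expect_draw_diff_le[OF h])
  also have "\<dots> \<le> \<delta> * ?C"
    using discount by (intro mult_right_mono dist add_nonneg_nonneg mult_nonneg_nonneg max_norm_nonneg)
  finally have "\<bar>backup M \<pi>1 \<pi>2 f W' s - backup M \<pi>1' \<pi>2 f W' s\<bar> \<le> \<delta> * ?C" .
  moreover have "discount M * \<bar>expect (next_state M \<pi>1 \<pi>2 s) (\<lambda>s. W s - W' s)\<bar> =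
      \<bar>backup M \<pi>1 \<pi>2 f W s - backup M \<pi>1 \<pi>2 f W' s\<bar>"
    using discount by (simp add: backup_def abs_mult flip: right_diff_distrib)
  ultimately show ?thesis
    by linarith
qed

text \<open>By the Bellman equation both values are backups of themselves, so their difference meets
  the discounted fixed-point bound.\<close>

lemma state_value_diff_le:
  "\<bar>state_value M \<pi>1 \<pi>2 f s - state_value M \<pi>1' \<pi>2 f s\<bar>
   \<le> \<delta> * (max_norm f + discount M * max_norm (state_value M \<pi>1' \<pi>2 f)) / (1 - discount M)"
proof (rule discounted_fixpoint_bound[OF discount, where p="next_state M \<pi>1 \<pi>2"
      and u="\<lambda>s. state_value M \<pi>1 \<pi>2 f s - state_value M \<pi>1' \<pi>2 f s"])
  fix s
  show "\<bar>state_value M \<pi>1 \<pi>2 f s - state_value M \<pi>1' \<pi>2 f s\<bar>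
    \<le> \<delta> * (max_norm f + discount M * max_norm (state_value M \<pi>1' \<pi>2 f)) +
      discount M * \<bar>expect (next_state M \<pi>1 \<pi>2 s) (\<lambda>s. state_value M \<pi>1 \<pi>2 f s - state_value M \<pi>1' \<pi>2 f s)\<bar>"
    using backup_diff_le[of \<pi>2 f "state_value M \<pi>1 \<pi>2 f" s "state_value M \<pi>1' \<pi>2 f"]
    by (simp only: state_value_Bellman[symmetric])
qed

text \<open>The first step uses \<open>\<pi>2'\<close> and the continuation \<open>\<pi>2\<close>,
  so no fixed point is at hand; one step on top of the value bound gives
  \<open>?c + \<gamma> * ?c / (1 - \<gamma>)\<close>, which is again
  \<open>?c / (1 - \<gamma>)\<close>.\<close>

lemma backup_state_value_diff_le:
  "\<bar>backup M \<pi>1 \<pi>2' f (state_value M \<pi>1 \<pi>2 f) s - backup M \<pi>1' \<pi>2' f (state_value M \<pi>1' \<pi>2 f) s\<bar>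
   \<le> \<delta> * (max_norm f + discount M * max_norm (state_value M \<pi>1' \<pi>2 f)) / (1 - discount M)"
  (is "?lhs \<le> ?c / _")
proof -
  have "?lhs \<le> ?c + discount M *
      \<bar>expect (next_state M \<pi>1 \<pi>2' s) (\<lambda>s. state_value M \<pi>1 \<pi>2 f s - state_value M \<pi>1' \<pi>2 f s)\<bar>"
    by (rule backup_diff_le)
  also have "\<dots> \<le> ?c + discount M * (?c / (1 - discount M))"
    by (intro add_left_mono mult_left_mono expect_abs_bound state_value_diff_le discount)
  also have "\<dots> = ?c / (1 - discount M)"
    using discount by (simp add: add_divide_eq_iff left_diff_distrib mult.commute)
  finally show ?thesis .
qed

end

end

section \<open>From the cost to the lower bound\<close>

text \<open>A p-norm dominates each coordinate.\<close>

lemma cost_ge_statewise: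
  fixes \<pi> \<pi>0 :: "('s::finite, 'a::finite) policy"
  assumes "1 \<le> p"
  shows "(\<Sum>a\<in>UNIV. \<bar>pmf (\<pi> s) a - pmf (\<pi>0 s) a\<bar>) \<le> cost p \<pi> \<pi>0"
proof -
  let ?d = "\<lambda>s. \<Sum>a\<in>UNIV. \<bar>pmf (\<pi> s) a - pmf (\<pi>0 s) a\<bar>"
  have "?d s = (?d s powr p) powr (1 / p)"
    using assms by (simp add: powr_powr sum_nonneg)
  also have "\<dots> \<le> (\<Sum>s\<in>UNIV. ?d s powr p) powr (1 / p)"
    using assms by (intro powr_mono2 member_le_sum) auto
  finally show ?thesis
    by (simp add: cost_def)
qed

lemma score_eq_disc_value:
  "score M \<pi>1 \<pi>2 = (1 - discount M) * disc_value M \<pi>1 \<pi>2 (\<lambda>(s, a1, a2). reward2 M s a1 a2) (init_dist M)"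
  by (simp add: score_def discounted_return_def disc_value_def)

lemma occupancy_eq_disc_value:
  "occupancy M \<pi>1 \<pi>2 s = (1 - discount M) * disc_value M \<pi>1 \<pi>2 (\<lambda>x. of_bool (fst x = s)) (init_dist M)"
  by (simp add: occupancy_def disc_value_def)

lemma val_eq_state_value:
  "val M \<pi>1 \<pi>2 = state_value M \<pi>1 \<pi>2 (\<lambda>(s, a1, a2). reward2 M s a1 a2)"
  by (simp add: fun_eq_iff val_def discounted_return_def state_value_def disc_value_def)

theorem theorem2:
  fixes M :: "('s::finite, 'a1::finite, 'a2::finite) two_agent_mdp"
    and \<pi>10 \<pi>1 :: "('s, 'a1) policy"
    and \<pi>2t :: "('s, 'a2) policy"
    and \<epsilon> p :: real
  assumes "0 \<le> discount M" and "discount M < 1"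
    and "deterministic \<pi>2t"
    and "\<epsilon> \<ge> 0" and "p \<ge> 1"
    and "attack_feasible M \<pi>2t \<epsilon> \<pi>1"
  shows "cost p \<pi>1 \<pi>10 \<ge>
    (1 - discount M) / 2 *
    (max_norm (\<lambda>(s, a2). chi_bar M \<pi>10 \<pi>2t 0 s a2) /
     (max_norm (\<lambda>(s, a1, a2). reward2 M s a1 a2) + discount M * max_norm (val M \<pi>10 \<pi>2t)))"
proof -
  let ?\<gamma> = "discount M"
  let ?r = "\<lambda>(s, a1, a2). reward2 M s a1 a2"
  let ?\<delta> = "cost p \<pi>1 \<pi>10"
  define C where "C = max_norm ?r + ?\<gamma> * max_norm (val M \<pi>10 \<pi>2t)"
  note disc = assms(1,2)
  have \<delta>: "0 \<le> ?\<delta>"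
    by (simp add: cost_def)
  have C: "0 \<le> C"
    unfolding C_def using disc by (intro add_nonneg_nonneg mult_nonneg_nonneg max_norm_nonneg)
  \<comment> \<open>The common bound on the change of V and of Q between \<open>\<pi>10\<close> and
    \<open>\<pi>1\<close>.\<close>
  define B where "B = ?\<delta> * C / (1 - ?\<gamma>)"
  have B: "0 \<le> B"
    unfolding B_def using \<delta> C disc by simp
  have chi: "chi_bar M \<pi>10 \<pi>2t 0 s a \<le> 2 * B" for s a
  proof (cases "(\<forall>\<pi>1. occupancy M \<pi>1 \<pi>2t s > 0) \<and> pmf (\<pi>2t s) a = 0")
    case True
    let ?\<pi>2' = "neighbor \<pi>2t s a"
    define adv where "adv \<pi> = backup M \<pi> ?\<pi>2' ?r (val M \<pi> \<pi>2t) s - val M \<pi> \<pi>2t s"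
      for \<pi> :: "('s, 'a1) policy"
    note same = neighbor_def[of \<pi>2t s a]
    have gap: "score M \<pi> ?\<pi>2' - score M \<pi> \<pi>2t = occupancy M \<pi> ?\<pi>2' s * adv \<pi>" for \<pi>
      using disc_value_change_at[OF disc same, of \<pi> ?r "init_dist M"]
      by (simp add: score_eq_disc_value occupancy_eq_disc_value adv_def val_eq_state_value mult.assoc
          flip: right_diff_distrib)
    \<comment> \<open>The case assumption covers every policy of agent 1, so this serves both
      \<open>\<pi>1\<close> and \<open>\<pi>10\<close>.\<close>
    have "occupancy M \<pi> ?\<pi>2' s \<noteq> 0" for \<pi>
    proof
      assume "occupancy M \<pi> ?\<pi>2' s = 0"
      then have "occupancy M \<pi> \<pi>2t s = 0"
        using disc disc_value_visits_change_at[OF disc same, of \<pi> "init_dist M"]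
        by (simp add: occupancy_eq_disc_value)
      with True show False
        by (metis less_irrefl)
    qed
    moreover have "0 \<le> occupancy M \<pi> ?\<pi>2' s" for \<pi>
    proof -
      have "0 \<le> (\<Sum>t. ?\<gamma> ^ t * of_bool (fst (\<omega> t) = s))" for \<omega> :: "nat \<Rightarrow> 's \<times> 'a1 \<times> 'a2"
        using disc by (intro suminf_nonneg summable_comparison_test'[OF summable_geometric[of ?\<gamma>], of 0]) auto
      then show ?thesis
        unfolding occupancy_def using disc by (intro mult_nonneg_nonneg Bochner_Integration.integral_nonneg) auto
    qed
    ultimately have occ: "0 < occupancy M \<pi> ?\<pi>2' s" for \<pi>
      by (metis less_eq_real_def)
    have "deterministic ?\<pi>2'"
      using assms(3) by (auto simp: deterministic_def neighbor_def)
    \<comment> \<open>Under \<open>\<pi>1\<close> and the target, \<open>s\<close> is visited, and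
      there the target gives \<open>a\<close> probability 0 while the neighbor gives it 1.\<close>
    moreover have "?\<pi>2' \<notin> target_class M \<pi>2t \<pi>1"
    proof
      assume "?\<pi>2' \<in> target_class M \<pi>2t \<pi>1"
      with True have "\<pi>2t s = return_pmf a"
        by (auto simp: target_class_def neighbor_def)
      with True show False
        by simp
    qed
    \<comment> \<open>The neighbor is thus a competitor in the constraint, which the target beats by
      at least \<epsilon> \<ge> 0.\<close>
    ultimately have "score M \<pi>1 ?\<pi>2' - score M \<pi>1 \<pi>2t \<le> 0"
      using assms(4,6) by (force simp: attack_feasible_def)
    with gap occ have "adv \<pi>1 \<le> 0"
      by (metis mult_pos_pos not_le)
    \<comment> \<open>The factor 2 counts one \<open>B\<close> for Q and one for V. The default
      policy takes the place of \<open>\<pi>1'\<close>, so its value enters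
      \<open>C\<close>.\<close>
    moreover have "adv \<pi>10 - adv \<pi>1 \<le> 2 * B"
      using backup_state_value_diff_le[where ?\<pi>1.0=\<pi>1 and \<pi>1'=\<pi>10 and ?\<pi>2.0=\<pi>2t and f="?r" and s=s
          and \<pi>2'="?\<pi>2'", OF disc cost_ge_statewise[OF assms(5)]]
        state_value_diff_le[where ?\<pi>1.0=\<pi>1 and \<pi>1'=\<pi>10 and ?\<pi>2.0=\<pi>2t and f="?r" and s=s,
          OF disc cost_ge_statewise[OF assms(5)]]
      unfolding adv_def val_eq_state_value[symmetric] C_def[symmetric] B_def[symmetric]
      by linarith
    \<comment> \<open>At \<epsilon>' = 0 the occupancy in the score gap cancels against the
      denominator.\<close>
    moreover have "chi_bar M \<pi>10 \<pi>2t 0 s a = max 0 (adv \<pi>10)"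
      using True occ[of \<pi>10] by (simp add: chi_bar_def gap)
    ultimately show ?thesis
      using B by simp
  next
    case False
    show ?thesis
      unfolding chi_bar_def if_not_P[OF False] using B by simp
  qed
  have "max_norm (\<lambda>(s, a2). chi_bar M \<pi>10 \<pi>2t 0 s a2) \<le> 2 * B"
  proof (rule max_norm_le)
    fix x
    show "\<bar>case x of (s, a2) \<Rightarrow> chi_bar M \<pi>10 \<pi>2t 0 s a2\<bar> \<le> 2 * B"
      using chi[of "fst x" "snd x"] by (simp add: case_prod_beta chi_bar_def)
  qed
  then have "(1 - ?\<gamma>) / 2 * max_norm (\<lambda>(s, a2). chi_bar M \<pi>10 \<pi>2t 0 s a2) \<le> ?\<delta> * C"
    using disc by (simp add: B_def field_simps)
  \<comment> \<open>If \<open>C = 0\<close> the quotient is 0 by convention and the claim is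
    nonnegativity of the cost.\<close>
  then have "(1 - ?\<gamma>) / 2 * (max_norm (\<lambda>(s, a2). chi_bar M \<pi>10 \<pi>2t 0 s a2) / C) \<le> ?\<delta>"
    using C \<delta> by (cases "C = 0") (auto simp: divide_le_eq)
  then show ?thesis
    by (simp add: C_def)
qed

end
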